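(* There exists a $0$-dimensional topological space of cardinality $2^{\omega}$ which has property $P_{<\omega}$.
   Context: For a natural number $n\ge 1$, a topological space $X$ has property $P_n$ if it is Hausdorff and, whenever $U_0,\dots,U_{n-1}$ are open subsets of $X$ with $\bigcap_{i<n}U_i=\emptyset$, we have $|U_i|\le\omega$ for some $i<n$. A space has property $P_{<\omega}$ if it has property $P_n$ for every $n<\omega$. A space is $0$-dimensional if it has a base of clopen sets. *)

theory Defs
  imports "HOL-Analysis.Analysis"
begin

definition zero_dimensional_space :: "'a topology \<Rightarrow> bool" where
  "zero_dimensional_space X \<longleftrightarrow>
     (\<exists>\<B>. (\<forall>B\<in>\<B>. openin X B \<and> closedin X B) \<and>
          openin X = arbitrary union_of (\<lambda>B. B \<in> \<B>))"

text \<open>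
  Only meant for \<open>n \<ge> 1\<close>; for \<open>n = 0\<close> the intersection is \<open>UNIV\<close> rather than \<open>topspace X\<close>.
\<close>
definition property_P :: "nat \<Rightarrow> 'a topology \<Rightarrow> bool" where
  "property_P n X \<longleftrightarrow>
     Hausdorff_space X \<and>
     (\<forall>U :: nat \<Rightarrow> 'a set.
        (\<forall>i<n. openin X (U i)) \<longrightarrow> (\<Inter>i<n. U i) = {} \<longrightarrow> (\<exists>i<n. countable (U i)))"

definition property_P_less_omega :: "'a topology \<Rightarrow> bool" where
  "property_P_less_omega X \<longleftrightarrow> (\<forall>n\<ge>1. property_P n X)"

end

theory Submission
  imports Defs "HOL-Library.Nat_Bijection"
begin

text \<open>
  Over a countable dense set \<open>D\<close> of isolated points with an independent family \<open>(B\<^sub>x)\<close> of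
  \<open>2\<^sup>\<omega>\<close> subsets, add one point \<open>x\<close> for each \<open>B\<^sub>x\<close>, with basic neighbourhoods
  \<open>{x} \<union> B\<^sub>x - \<Union>\<^bsub>y\<in>F\<^esub> B\<^sub>y - E\<close> for finite \<open>F\<close> and \<open>E\<close>. If \<open>n\<close> open sets are uncountable, a free
  set argument picks a new point \<open>x\<^sub>i\<close> in the \<open>i\<close>-th one so that no \<open>x\<^sub>i\<close> belongs to the finite
  set \<open>F\<close> attached to any \<open>x\<^sub>j\<close>; independence then gives a point of \<open>D\<close> in all \<open>n\<close> sets.
  Here \<open>D\<close> consists of the finite subsets of \<open>\<nat>\<close>, the new points are the infinite ones, and
  \<open>B\<^sub>x\<close> is the set of those finite sets that contain a code of some \<open>x \<inter> {0,\<dots>,m-1}\<close>.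
\<close>

section \<open>Topologies generated by a subbase closed under complements\<close>

lemma zero_dimensional_spaceI:
  assumes "\<And>U x. \<lbrakk>openin X U; x \<in> U\<rbrakk> \<Longrightarrow> \<exists>B. openin X B \<and> closedin X B \<and> x \<in> B \<and> B \<subseteq> U"
  shows "zero_dimensional_space X"
proof -
  let ?\<B> = "{B. openin X B \<and> closedin X B}"
  have "openin X U \<longleftrightarrow> (arbitrary union_of (\<lambda>B. B \<in> ?\<B>)) U" for U
  proof
    assume U: "openin X U"
    let ?\<U> = "{B \<in> ?\<B>. B \<subseteq> U}"
    have "\<Union>?\<U> = U"
    proof
      show "U \<subseteq> \<Union>?\<U>"
      proof
        fix x
        assume "x \<in> U"
        then obtain B where "openin X B" "closedin X B" "x \<in> B" "B \<subseteq> U"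
          using assms[OF U] by metis
        then show "x \<in> \<Union>?\<U>" by blast
      qed
    qed blast
    then show "(arbitrary union_of (\<lambda>B. B \<in> ?\<B>)) U"
      unfolding union_of_def arbitrary_def by (intro exI[of _ ?\<U>]) auto
  next
    assume "(arbitrary union_of (\<lambda>B. B \<in> ?\<B>)) U"
    then show "openin X U"
      unfolding union_of_def by (auto intro: openin_Union)
  qed
  then have "openin X = arbitrary union_of (\<lambda>B. B \<in> ?\<B>)"
    by (rule ext)
  then show ?thesis
    unfolding zero_dimensional_space_def by (intro exI[of _ ?\<B>]) simp
qed

text \<open>Each subbasic set is clopen because its complement is subbasic too. Containing a clopen
  neighbourhood of each of its points passes from sets to their binary intersections and arbitrary
  unions, so induction over the generation of the open sets suffices.\<close>

lemma zero_dimensional_topology_generated_by: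
  assumes "\<And>S. S \<in> \<S> \<Longrightarrow> \<Union>\<S> - S \<in> \<S>"
  shows "zero_dimensional_space (topology_generated_by \<S>)"
proof (rule zero_dimensional_spaceI)
  let ?X = "topology_generated_by \<S>"
  fix U x
  assume "openin ?X U" and "x \<in> U"
  then have "generate_topology_on \<S> U"
    by (simp add: openin_topology_generated_by_iff)
  then show "\<exists>B. openin ?X B \<and> closedin ?X B \<and> x \<in> B \<and> B \<subseteq> U"
    using \<open>x \<in> U\<close>
  proof induction
    case (Int U V)
    then obtain A B where
      "openin ?X A" "closedin ?X A" "x \<in> A" "A \<subseteq> U"
      "openin ?X B" "closedin ?X B" "x \<in> B" "B \<subseteq> V"
      by blast
    then show ?case
      by (intro exI[of _ "A \<inter> B"] conjI openin_Int closedin_Int) auto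
  next
    case (UN K)
    then obtain V where "V \<in> K" "x \<in> V" by blast
    with UN.IH[of V] obtain B where "openin ?X B" "closedin ?X B" "x \<in> B" "B \<subseteq> V" by blast
    with \<open>V \<in> K\<close> show ?case by blast
  next
    case (Basis S)
    then have "openin ?X S" "openin ?X (\<Union>\<S> - S)"
      using assms by (simp_all add: topology_generated_by_Basis)
    then have "closedin ?X S"
      using Basis by (simp add: closedin_def Sup_upper)
    with \<open>openin ?X S\<close> Basis show ?case by blast
  qed simp
qed

lemma Hausdorff_topology_generated_by:
  assumes compl: "\<And>S. S \<in> \<S> \<Longrightarrow> \<Union>\<S> - S \<in> \<S>"
    and sep: "\<And>x y. \<lbrakk>x \<in> \<Union>\<S>; y \<in> \<Union>\<S>; x \<noteq> y\<rbrakk> \<Longrightarrow> \<exists>S\<in>\<S>. x \<in> S \<longleftrightarrow> y \<notin> S"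
  shows "Hausdorff_space (topology_generated_by \<S>)"
  unfolding Hausdorff_space_def topology_generated_by_topspace
proof (intro allI impI, elim conjE)
  fix x y
  assume *: "x \<in> \<Union>\<S>" "y \<in> \<Union>\<S>" "x \<noteq> y"
  then obtain S where S: "S \<in> \<S>" "x \<in> S \<longleftrightarrow> y \<notin> S"
    using sep by blast
  let ?X = "topology_generated_by \<S>"
  have op: "openin ?X S" "openin ?X (\<Union>\<S> - S)"
    using S compl by (simp_all add: topology_generated_by_Basis)
  show "\<exists>U V. openin ?X U \<and> openin ?X V \<and> x \<in> U \<and> y \<in> V \<and> disjnt U V"
  proof (cases "x \<in> S")
    case True
    then show ?thesis
      using S * op by (intro exI[of _ S] exI[of _ "\<Union>\<S> - S"]) (auto simp: disjnt_def)
  next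
    case False
    then show ?thesis
      using S * op by (intro exI[of _ S] exI[of _ "\<Union>\<S> - S"]) (auto simp: disjnt_def)
  qed
qed

text \<open>In the induction step the choice from \<open>C n\<close> is postponed: first only a
  countably infinite \<open>S\<close> inside it is fixed. Removing all \<open>F n x\<close> with
  \<open>x\<close> in \<open>S\<close> costs the other sets countably many points, so they stay
  uncountable and the induction hypothesis applies. The values it yields exclude only finitely many
  elements of \<open>S\<close>, and any remaining one can be the last value.\<close>

lemma free_transversal:
  fixes C :: "nat \<Rightarrow> 'a set" and F :: "nat \<Rightarrow> 'a \<Rightarrow> 'a set"
  assumes "\<And>i. i < n \<Longrightarrow> uncountable (C i)"
    and "\<And>i x. \<lbrakk>i < n; x \<in> C i\<rbrakk> \<Longrightarrow> finite (F i x)"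
  shows "\<exists>f. (\<forall>i<n. f i \<in> C i) \<and> (\<forall>i<n. \<forall>j<n. i \<noteq> j \<longrightarrow> f i \<notin> F j (f j))"
  using assms
proof (induction n arbitrary: C)
  case 0
  then show ?case by simp
next
  case (Suc n)
  have "infinite (C n)"
    using Suc.prems(1)[of n] uncountable_infinite by blast
  then obtain S where S: "S \<subseteq> C n" "countable S" "infinite S"
    using infinite_countable_subset' by metis
  let ?T = "\<Union>x\<in>S. F n x"
  have "countable ?T"
    using S Suc.prems(2)[of n] by (intro countable_UN) (auto intro: countable_finite)
  then have "uncountable (C i - ?T)" if "i < n" for i
    using Suc.prems(1)[of i] that by (simp add: uncountable_minus_countable)
  then obtain f where f: "\<And>i. i < n \<Longrightarrow> f i \<in> C i - ?T"
    and free: "\<And>i j. \<lbrakk>i < n; j < n; i \<noteq> j\<rbrakk> \<Longrightarrow> f i \<notin> F j (f j)"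
    using Suc.IH[of "\<lambda>i. C i - ?T"] Suc.prems(2) by (metis DiffD1 less_SucI)
  have "finite (\<Union>j<n. F j (f j))"
    using f Suc.prems(2) by auto
  then obtain s where s: "s \<in> S" "s \<notin> (\<Union>j<n. F j (f j))"
    using S(3) by (meson finite_subset subsetI)
  show ?case
  proof (intro exI[of _ "f(n := s)"] conjI allI impI)
    show "(f(n := s)) i \<in> C i" if "i < Suc n" for i
      using that f s S by (auto simp: less_Suc_eq)
    show "(f(n := s)) i \<notin> F j ((f(n := s)) j)" if "i < Suc n" "j < Suc n" "i \<noteq> j" for i j
      using that f s free by (auto simp: less_Suc_eq)
  qed
qed

section \<open>An independent family of sets of finite subsets of \<open>nat\<close>\<close>

definition prefix_code :: "nat \<Rightarrow> nat set \<Rightarrow> nat" where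
  "prefix_code m x = prod_encode (m, set_encode (x \<inter> {..<m}))"

lemma prefix_code_eq_iff:
  "prefix_code m x = prefix_code k y \<longleftrightarrow> m = k \<and> x \<inter> {..<m} = y \<inter> {..<m}"
  unfolding prefix_code_def by (auto simp: set_encode_eq)

lemma le_prefix_code: "m \<le> prefix_code m x"
  unfolding prefix_code_def by (rule le_prod_encode_1)

definition prefix_trace :: "nat set \<Rightarrow> nat set set" where
  "prefix_trace x = {d. finite d \<and> (\<exists>m. prefix_code m x \<in> d)}"

lemma eventually_prefix_neq:
  fixes x y :: "nat set"
  assumes "x \<noteq> y"
  shows "\<forall>\<^sub>F m in sequentially. x \<inter> {..<m} \<noteq> y \<inter> {..<m}"
proof -
  obtain k where "k \<in> x \<longleftrightarrow> k \<notin> y"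
    using assms by blast
  then have "x \<inter> {..<m} \<noteq> y \<inter> {..<m}" if "k < m" for m
    using that by (metis Int_iff lessThan_iff)
  then show ?thesis
    using eventually_gt_at_top[of k] by (rule eventually_mono[rotated])
qed

text \<open>The witness collects the codes of the length-\<open>m\<close> prefixes of the members of
  \<open>P\<close>. A code records its length, so a \<open>y\<close> in \<open>N\<close> could only
  be hit through its own length-\<open>m\<close> prefix, and for large \<open>m\<close> this differs
  from those of \<open>P\<close>. Codes are at least \<open>m\<close>, which for large
  \<open>m\<close> keeps the witness out of \<open>E\<close>.\<close>

lemma prefix_trace_independent:
  assumes "finite P" "P \<noteq> {}" "finite N" "P \<inter> N = {}" "finite E"
  shows "\<exists>d. finite d \<and> (\<forall>x\<in>P. d \<in> prefix_trace x) \<and> (\<forall>y\<in>N. d \<notin> prefix_trace y) \<and> d \<notin> E"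
proof -
  have "\<forall>\<^sub>F m in sequentially. \<forall>x\<in>P. \<forall>y\<in>N. x \<inter> {..<m} \<noteq> y \<inter> {..<m}"
    using assms(1,3,4)
    by (intro eventually_ball_finite ballI eventually_prefix_neq) (assumption | blast)+
  \<comment> \<open>\<open>E\<close> may have infinite members, which no \<open>m\<close> bounds;
    these cannot equal the finite witness anyway.\<close>
  moreover have "\<forall>\<^sub>F m in sequentially. \<forall>d\<in>E. d \<inter> {m..} \<noteq> {} \<longrightarrow> infinite d"
  proof (intro eventually_ball_finite ballI \<open>finite E\<close>)
    fix d :: "nat set"
    show "\<forall>\<^sub>F m in sequentially. d \<inter> {m..} \<noteq> {} \<longrightarrow> infinite d"
    proof (cases "finite d")
      case True
      then obtain b where "\<forall>k\<in>d. k \<le> b"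
        using finite_nat_set_iff_bounded_le by blast
      then show ?thesis
        by (intro eventually_mono[OF eventually_gt_at_top[of b]]) fastforce
    qed simp
  qed
  ultimately have "\<exists>m. (\<forall>x\<in>P. \<forall>y\<in>N. x \<inter> {..<m} \<noteq> y \<inter> {..<m}) \<and>
      (\<forall>d\<in>E. d \<inter> {m..} \<noteq> {} \<longrightarrow> infinite d)"
    by (intro eventually_happens'[OF sequentially_bot] eventually_conj)
  then obtain m where m: "\<forall>x\<in>P. \<forall>y\<in>N. x \<inter> {..<m} \<noteq> y \<inter> {..<m}"
    and E: "\<forall>d\<in>E. d \<inter> {m..} \<noteq> {} \<longrightarrow> infinite d"
    by blast
  let ?d = "prefix_code m ` P"
  have fin: "finite ?d"
    using assms by simp
  have "?d \<inter> {m..} \<noteq> {}"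
    using \<open>P \<noteq> {}\<close> le_prefix_code by auto
  then have "?d \<notin> E"
    using bspec[OF E, of ?d] fin by metis
  moreover have "?d \<in> prefix_trace x" if "x \<in> P" for x
    using that fin by (auto simp: prefix_trace_def)
  moreover have "?d \<notin> prefix_trace y" if "y \<in> N" for y
  proof
    assume "?d \<in> prefix_trace y"
    then obtain k x where "x \<in> P" "prefix_code k y = prefix_code m x"
      unfolding prefix_trace_def by blast
    with m that show False
      unfolding prefix_code_eq_iff by metis
  qed
  ultimately show ?thesis
    using fin by blast
qed

section \<open>The subbase and the neighbourhoods of infinite points\<close>

definition cell :: "nat set \<Rightarrow> nat set set" where
  "cell x = (if finite x then {x} else insert x (prefix_trace x))"

definition cells :: "nat set set set" where
  "cells = range cell \<union> range (\<lambda>x. - cell x)"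

lemma mem_cell_self: "x \<in> cell x"
  by (simp add: cell_def)

lemma mem_cell_infinite: "infinite x \<Longrightarrow> x \<in> cell y \<longleftrightarrow> x = y"
  by (auto simp: cell_def prefix_trace_def)

lemma cell_in_cells: "cell x \<in> cells"
  by (simp add: cells_def)

lemma compl_cell_in_cells: "- cell x \<in> cells"
  by (simp add: cells_def)

lemma cellsE:
  assumes "S \<in> cells"
  obtains x where "S = cell x" | x where "S = - cell x"
  using assms unfolding cells_def by (elim UnE imageE)

lemma Union_cells: "\<Union>cells = UNIV"
  using mem_cell_self cell_in_cells by (metis UNIV_eq_I UnionI)

lemma compl_cells: "S \<in> cells \<Longrightarrow> \<Union>cells - S \<in> cells"
  unfolding Union_cells Compl_eq_Diff_UNIV[symmetric]
  by (erule cellsE) (simp_all add: cell_in_cells compl_cell_in_cells)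

text \<open>\<open>cell x\<close> can contain a \<open>y\<close> other than \<open>x\<close> only if
  \<open>x\<close> is infinite and \<open>y\<close> finite; then \<open>cell y\<close> is the
  singleton of \<open>y\<close> and separates instead.\<close>

lemma cells_separate:
  assumes "x \<noteq> y"
  shows "\<exists>S\<in>cells. x \<in> S \<longleftrightarrow> y \<notin> S"
proof (cases "finite x \<or> infinite y")
  case True
  then have "y \<notin> cell x"
    using assms by (auto simp: cell_def prefix_trace_def)
  then show ?thesis
    using mem_cell_self[of x] by (intro bexI[OF _ cell_in_cells[of x]]) simp
next
  case False
  then have "x \<notin> cell y"
    using assms by (simp add: cell_def)
  then show ?thesis
    using mem_cell_self[of y] by (intro bexI[OF _ cell_in_cells[of y]]) simp
qed

text \<open>An infinite \<open>x\<close> lies in no cell but its own, so the subbasic sets around it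
  are \<open>cell x\<close> and complements of cells of other points. Intersecting neighbourhoods
  unites their exceptional sets \<open>F\<close> and \<open>E\<close>, which stay finite.\<close>

lemma open_contains_trace:
  assumes "openin (topology_generated_by cells) U" "infinite x" "x \<in> U"
  shows "\<exists>F E. finite F \<and> finite E \<and> x \<notin> F \<and> prefix_trace x - (\<Union>y\<in>F. prefix_trace y) - E \<subseteq> U"
proof -
  have "generate_topology_on cells U"
    using assms by (simp add: openin_topology_generated_by_iff)
  then show ?thesis
    using assms(3)
  proof induction
    case (Int U V)
    then have "x \<in> U" "x \<in> V" by simp_all
    obtain F E where FE: "finite F" "finite E" "x \<notin> F"
      "prefix_trace x - (\<Union>y\<in>F. prefix_trace y) - E \<subseteq> U"
      using Int.IH(1)[OF \<open>x \<in> U\<close>] by (elim exE conjE)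
    obtain F' E' where FE': "finite F'" "finite E'" "x \<notin> F'"
      "prefix_trace x - (\<Union>y\<in>F'. prefix_trace y) - E' \<subseteq> V"
      using Int.IH(2)[OF \<open>x \<in> V\<close>] by (elim exE conjE)
    have "prefix_trace x - (\<Union>y\<in>F \<union> F'. prefix_trace y) - (E \<union> E') \<subseteq> U \<inter> V"
      using FE(4) FE'(4) by blast
    then show ?case
      using FE FE' by (intro exI[of _ "F \<union> F'"] exI[of _ "E \<union> E'"]) simp
  next
    case (UN K)
    then obtain V where V: "V \<in> K" "x \<in> V" by blast
    obtain F E where FE: "finite F" "finite E" "x \<notin> F"
      "prefix_trace x - (\<Union>y\<in>F. prefix_trace y) - E \<subseteq> V"
      using UN.IH[OF V] by (elim exE conjE)
    from FE(4) Union_upper[OF V(1)]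
    have "prefix_trace x - (\<Union>y\<in>F. prefix_trace y) - E \<subseteq> \<Union>K"
      by (rule subset_trans)
    with FE(1-3) show ?case
      by (intro exI conjI)
  next
    case (Basis S)
    from \<open>S \<in> cells\<close> consider "S = cell x" | y where "S = - cell y" "y \<noteq> x"
    proof (cases rule: cellsE)
      case (1 y)
      with Basis mem_cell_infinite[OF \<open>infinite x\<close>] that(1) show thesis by simp
    next
      case (2 y)
      with Basis mem_cell_self that(2) show thesis by auto
    qed
    then show ?case
    proof cases
      case 1
      then show ?thesis
        using \<open>infinite x\<close> by (intro exI[of _ "{}"]) (auto simp: cell_def)
    next
      case 2
      \<comment> \<open>If \<open>y\<close> is infinite, \<open>F\<close> removes the trace inside
        \<open>cell y\<close>; if \<open>y\<close> is finite, \<open>cell y\<close> is a singleton,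
        which \<open>E\<close> removes. The same witnesses serve both cases.\<close>
      then show ?thesis
        by (intro exI[of _ "{y}"] exI[of _ "{y}"]) (auto simp: cell_def)
    qed
  qed simp
qed

text \<open>This is the contrapositive of the condition in \<open>property_P\<close>. There are only
  countably many finite sets of naturals, so each \<open>U i\<close> keeps uncountably many infinite
  points, among which the free transversal is chosen.\<close>

lemma Inter_uncountable_open_nonempty:
  fixes U :: "nat \<Rightarrow> nat set set"
  assumes "n \<ge> 1"
    and op: "\<And>i. i < n \<Longrightarrow> openin (topology_generated_by cells) (U i)"
    and unc: "\<And>i. i < n \<Longrightarrow> uncountable (U i)"
  shows "(\<Inter>i<n. U i) \<noteq> {}"
proof -
  define C where "C i = U i - Collect finite" for i
  have unc_C: "uncountable (C i)" if "i < n" for i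
    using unc[OF that] countable_Collect_finite unfolding C_def
    by (rule uncountable_minus_countable)
  have "\<exists>F E. finite F \<and> finite E \<and> x \<notin> F \<and>
      prefix_trace x - (\<Union>y\<in>F. prefix_trace y) - E \<subseteq> U i" if "i < n" "x \<in> C i" for i x
    using open_contains_trace[OF op[OF that(1)]] that(2) unfolding C_def by simp
  then obtain F E where FE: "\<And>i x. \<lbrakk>i < n; x \<in> C i\<rbrakk> \<Longrightarrow> finite (F i x) \<and> finite (E i x) \<and> x \<notin> F i x \<and>
      prefix_trace x - (\<Union>y\<in>F i x. prefix_trace y) - E i x \<subseteq> U i"
    by metis
  obtain f where f: "\<And>i. i < n \<Longrightarrow> f i \<in> C i"
    and free: "\<And>i j. \<lbrakk>i < n; j < n; i \<noteq> j\<rbrakk> \<Longrightarrow> f i \<notin> F j (f j)"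
    using free_transversal[of n C F] unc_C FE by metis
  \<comment> \<open>The transversal covers distinct indices; the diagonal case is
    \<open>x \<notin> F i x\<close>.\<close>
  have free': "f i \<notin> F j (f j)" if "i < n" "j < n" for i j
    using that free f FE by metis
  have "f ` {..<n} \<noteq> {}"
    using \<open>n \<ge> 1\<close> by (auto simp: lessThan_empty_iff)
  moreover have "f ` {..<n} \<inter> (\<Union>i<n. F i (f i)) = {}"
    using free' by auto
  moreover have "finite (\<Union>i<n. F i (f i))" "finite (\<Union>i<n. E i (f i))"
    using f FE by auto
  ultimately obtain d where d: "\<forall>x\<in>f ` {..<n}. d \<in> prefix_trace x"
    "\<forall>y\<in>(\<Union>i<n. F i (f i)). d \<notin> prefix_trace y" "d \<notin> (\<Union>i<n. E i (f i))"
    using prefix_trace_independent[of "f ` {..<n}" "\<Union>i<n. F i (f i)" "\<Union>i<n. E i (f i)"]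
    by (metis finite_imageI finite_lessThan)
  have "d \<in> U i" if "i < n" for i
  proof -
    have "d \<in> prefix_trace (f i) - (\<Union>y\<in>F i (f i). prefix_trace y) - E i (f i)"
      using d that by simp
    with FE[OF that f[OF that]] show ?thesis by (elim conjE) (rule subsetD)
  qed
  then show ?thesis by blast
qed

theorem proposition2p1:
  shows "\<exists>X :: nat set topology.
           topspace X \<approx> (UNIV :: nat set set) \<and>
           zero_dimensional_space X \<and>
           property_P_less_omega X"
proof (intro exI conjI)
  let ?X = "topology_generated_by cells"
  \<comment> \<open>Every set of naturals is a point, so the space has the cardinality of the
    continuum.\<close>
  show "topspace ?X \<approx> (UNIV :: nat set set)"
    by (simp add: topology_generated_by_topspace Union_cells)
  show "zero_dimensional_space ?X"
    using compl_cells by (rule zero_dimensional_topology_generated_by)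
  have "Hausdorff_space ?X"
    using compl_cells cells_separate by (rule Hausdorff_topology_generated_by)
  then show "property_P_less_omega ?X"
    unfolding property_P_less_omega_def property_P_def
    using Inter_uncountable_open_nonempty by metis
qed

end
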